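(* Assume that the singular values satisfy the polynomial spectral decay condition $C_A^{-1}i^{-p}\le\lambda_i\le C_Ai^{-p}$, $i=1,\dots,D$, with $\alpha p\le 1/4$, and that the critical value $\kappa$ satisfies $\big|\kappa-\sum_{i=1}^D\lambda_i^{2\alpha}\delta^2\big|\le C_\kappa s_D\delta^2$. Then, for any $\mu\in\mathbb{R}^D$, $$\mathbb{E}\|\widehat{\mu}^{(\tau_\alpha)}-\mu\|^2\ge C\,s_D^{(2p+1)/(1-2\alpha p)}\delta^2$$ with an absolute constant $C>0$, provided that $\delta$ is sufficiently small and $D=D_\delta\to\infty$ for $\delta\to 0$.
   Context: Model: one observes $Y_i=\lambda_i\mu_i+\delta\varepsilon_i$, $i=1,\dots,D$, where $\varepsilon_1,\dots,\varepsilon_D$ are independent standard Gaussian random variables, $\delta>0$ is the noise level, $\mu=(\mu_i)_{i\le D}\in\mathbb{R}^D$ is the unknown signal and $1\ge\lambda_1\ge\dots\ge\lambda_D>0$ are the singular values of the operator. $\|\cdot\|$ is the Euclidean norm. Parameters: $p\ge 0$ and $C_A\ge 1$ are the constants of the spectral decay condition, $C_\kappa>0$ is an absolute constant, $\kappa>0$ is the critical value, and $\alpha\ge 0$ is the smoothing index; all smoothing indices are assumed to be bounded from above by some $\bar\alpha>0$. The quantity $s_D>0$ is defined by $s_D^2=2\sum_{i=1}^D\lambda_i^{4\alpha}$. Estimators: for integers $0\le m\le D$, $\widehat{\mu}^{(m)}_i=\mathbf{1}\{i\le m\}\lambda_i^{-1}Y_i$, $i=1,\dots,D$. Stopping time: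 $R^2_{m,\alpha}=\sum_{i=m+1}^D\lambda_i^{2\alpha}Y_i^2$ and $\tau_\alpha=\inf\{m\in\mathbb{N}\cup\{0\}:R^2_{m,\alpha}\le\kappa\}$. *)

theory Defs
  imports "HOL-Probability.Probability"
begin

text \<open>
  Vectors of length \<open>D\<close> are functions \<open>nat \<Rightarrow> real\<close> of which only the values at the indices
  \<open>1, \<dots>, D\<close> matter; the dimension cannot be a type because it varies with the noise level.
  Their Euclidean norm is \<open>L2_set _ {1..D}\<close>.
\<close>

definition singular_values :: "nat \<Rightarrow> (nat \<Rightarrow> real) \<Rightarrow> bool" where
  "singular_values D lam \<longleftrightarrow>
     (\<forall>i\<in>{1..D}. 0 < lam i \<and> lam i \<le> 1) \<and>
     (\<forall>i\<in>{1..D}. \<forall>j\<in>{1..D}. i \<le> j \<longrightarrow> lam j \<le> lam i)"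

definition polynomial_decay :: "real \<Rightarrow> real \<Rightarrow> nat \<Rightarrow> (nat \<Rightarrow> real) \<Rightarrow> bool" where
  "polynomial_decay p C_A D lam \<longleftrightarrow>
     (\<forall>i\<in>{1..D}. inverse C_A * real i powr (- p) \<le> lam i \<and> lam i \<le> C_A * real i powr (- p))"

definition standard_gaussian_noise :: "'a measure \<Rightarrow> nat \<Rightarrow> (nat \<Rightarrow> 'a \<Rightarrow> real) \<Rightarrow> bool" where
  "standard_gaussian_noise M D eps \<longleftrightarrow>
     prob_space M \<and>
     (\<forall>i\<in>{1..D}. distributed M lborel (eps i) std_normal_density) \<and>
     prob_space.indep_vars M (\<lambda>_. borel) eps {1..D}"

definition observation ::
  "(nat \<Rightarrow> real) \<Rightarrow> (nat \<Rightarrow> real) \<Rightarrow> real \<Rightarrow> (nat \<Rightarrow> 'a \<Rightarrow> real) \<Rightarrow> 'a \<Rightarrow> nat \<Rightarrow> real" where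
  "observation lam mu \<delta> eps \<omega> i = lam i * mu i + \<delta> * eps i \<omega>"

definition svd_estimator :: "(nat \<Rightarrow> real) \<Rightarrow> (nat \<Rightarrow> real) \<Rightarrow> nat \<Rightarrow> nat \<Rightarrow> real" where
  "svd_estimator lam Y m i = (if i \<le> m then inverse (lam i) * Y i else 0)"

definition s_dim :: "real \<Rightarrow> nat \<Rightarrow> (nat \<Rightarrow> real) \<Rightarrow> real" where
  "s_dim \<alpha> D lam = sqrt (2 * (\<Sum>i=1..D. lam i powr (4 * \<alpha>)))"

definition smoothed_residual_sq ::
  "real \<Rightarrow> nat \<Rightarrow> (nat \<Rightarrow> real) \<Rightarrow> (nat \<Rightarrow> real) \<Rightarrow> nat \<Rightarrow> real" where
  "smoothed_residual_sq \<alpha> D lam Y m = (\<Sum>i=m+1..D. lam i powr (2 * \<alpha>) * (Y i)\<^sup>2)"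

text \<open>
  For \<open>\<kappa> \<ge> 0\<close> the set contains \<open>D\<close>, since the residual at \<open>m = D\<close> is an empty sum.
  So the infimum is attained and is at most \<open>D\<close>.
\<close>

definition stopping_time ::
  "real \<Rightarrow> nat \<Rightarrow> (nat \<Rightarrow> real) \<Rightarrow> real \<Rightarrow> (nat \<Rightarrow> real) \<Rightarrow> nat" where
  "stopping_time \<alpha> D lam \<kappa> Y = Inf {m. smoothed_residual_sq \<alpha> D lam Y m \<le> \<kappa>}"

definition stopped_risk ::
  "'a measure \<Rightarrow> real \<Rightarrow> nat \<Rightarrow> (nat \<Rightarrow> real) \<Rightarrow> (nat \<Rightarrow> real) \<Rightarrow> real \<Rightarrow> (nat \<Rightarrow> 'a \<Rightarrow> real) \<Rightarrow> real \<Rightarrow> real"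
where
  "stopped_risk M \<alpha> D lam mu \<delta> eps \<kappa> =
     prob_space.expectation M
       (\<lambda>\<omega>. let Y = observation lam mu \<delta> eps \<omega>;
                muhat = svd_estimator lam Y (stopping_time \<alpha> D lam \<kappa> Y)
            in (L2_set (\<lambda>i. muhat i - mu i) {1..D})\<^sup>2)"

end

theory Submission
  imports Defs
begin

text \<open>
  The lower bound is caused by the randomness of the residual alone. Write \<open>w i = lam i powr (2 * \<alpha>)\<close>
  and \<open>s = s_dim \<alpha> D lam\<close>. Without any signal, the residual at \<open>m = 0\<close> has mean \<open>\<delta>\<^sup>2 * (\<Sum>i\<le>D. w i)\<close>
  and standard deviation \<open>\<delta>\<^sup>2 * s\<close>, and \<open>\<kappa>\<close> differs from this mean by at most a constant number of
  standard deviations. Choose \<open>m\<close> of order \<open>s powr (1 / (1 - 2 * \<alpha> * p))\<close>. Then \<open>\<Sum>i\<le>m. w i\<close> is of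
  order \<open>s\<close>, so passing from the residual at 0 to the residual at \<open>m\<close> costs only a constant number of
  standard deviations more (\<open>exists_truncation_level\<close>). Hence the residual at \<open>m\<close> is above \<open>\<kappa>\<close>, and
  the stopping time exceeds \<open>m\<close>, with a probability bounded away from 0
  (\<open>prob_tail_exceeds_threshold\<close>). On this event the first \<open>m\<close> coordinates are estimated with
  noise of total variance \<open>\<delta>\<^sup>2 * (\<Sum>i\<le>m. (inverse (lam i))\<^sup>2)\<close>, which is at least of order
  \<open>\<delta>\<^sup>2 * m powr (2 * p + 1)\<close>, the asserted rate. Since the event depends on the noise beyond \<open>m\<close>
  only, the two factors are independent and the risk is at least their product (\<open>stopped_risk_ge\<close>).

  Two points need an argument that is uniform in \<open>\<alpha>\<close>, the singular values and the signal. The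
  probability that a weighted sum of centred chi-square variables exceeds a given multiple of its
  standard deviation is bounded below by the Paley-Zygmund inequality applied to the exponential of
  that sum (\<open>weighted_chi_square_upper_deviation\<close>). An arbitrary signal costs at most a factor 2
  compared with pure noise, by the symmetry of the Gaussian distribution
  (\<open>prob_central_le_twice_noncentral\<close>).
\<close>

section \<open>Deviations of weighted chi-square sums\<close>

text \<open>
  Where \<open>Y\<close> exceeds half its mean \<open>y\<close>, the inequality \<open>Y \<le> c Y\<^sup>2 / 2 + 1 / (2 c)\<close> applies, and
  elsewhere \<open>Y \<le> y / 2\<close>. Integrating the sum of the two bounds and optimising \<open>c\<close> replaces the
  usual appeal to the Cauchy-Schwarz inequality.
\<close>

lemma (in prob_space) paley_zygmund_half:
  fixes Y :: "'a \<Rightarrow> real"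
  assumes [measurable]: "random_variable borel Y"
    and sq: "integrable M (\<lambda>\<omega>. (Y \<omega>)\<^sup>2)" and pos: "0 < expectation Y"
  shows "(expectation Y)\<^sup>2 / (4 * expectation (\<lambda>\<omega>. (Y \<omega>)\<^sup>2))
    \<le> prob {\<omega> \<in> space M. expectation Y / 2 < Y \<omega>}"
proof -
  define y where "y = expectation Y"
  define q where "q = expectation (\<lambda>\<omega>. (Y \<omega>)\<^sup>2)"
  define A where "A = {\<omega> \<in> space M. y / 2 < Y \<omega>}"
  have A[measurable]: "A \<in> events" unfolding A_def by measurable
  have iY: "integrable M Y" by (rule square_integrable_imp_integrable[OF _ sq]) simp
  show ?thesis
  proof (cases "q = 0")
    case True
    then show ?thesis by (simp add: q_def)
  next
    case False
    have "q \<ge> 0" unfolding q_def by simp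
    with False have q: "q > 0" by simp
    have y: "y > 0" using pos y_def by simp
    \<comment> \<open>this \<open>c\<close> makes the quadratic term contribute \<open>y / 4\<close>, half of what is missing\<close>
    define c where "c = y / (2 * q)"
    have c: "c > 0" using y q by (simp add: c_def)
    have iA: "integrable M (indicator A :: 'a \<Rightarrow> real)"
      using A by (simp add: integrable_indicator_iff emeasure_eq_measure)
    have "y \<le> expectation (\<lambda>\<omega>. y / 2 + c * (Y \<omega>)\<^sup>2 / 2 + indicator A \<omega> / (2 * c))"
      unfolding y_def
    proof (rule integral_mono)
      show "integrable M (\<lambda>\<omega>. expectation Y / 2 + c * (Y \<omega>)\<^sup>2 / 2 + indicator A \<omega> / (2 * c))"
        using iA sq by simp
      fix \<omega> assume \<omega>: "\<omega> \<in> space M"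
      have "0 \<le> (c * Y \<omega> - 1)\<^sup>2 / (2 * c)" using c by simp
      also have "\<dots> = c * (Y \<omega>)\<^sup>2 / 2 + 1 / (2 * c) - Y \<omega>"
        using c by (simp add: power2_eq_square field_simps)
      finally have *: "Y \<omega> \<le> c * (Y \<omega>)\<^sup>2 / 2 + 1 / (2 * c)" by simp
      have "0 \<le> c * (Y \<omega>)\<^sup>2 / 2" using c by simp
      then show "Y \<omega> \<le> expectation Y / 2 + c * (Y \<omega>)\<^sup>2 / 2 + indicator A \<omega> / (2 * c)"
        using * y \<omega> unfolding y_def[symmetric]
        by (cases "\<omega> \<in> A") (auto simp: A_def)
    qed (use iY in simp)
    also have "\<dots> = y / 2 + c * q / 2 + prob A / (2 * c)"
      using iA sq A by (simp add: q_def prob_space Bochner_Integration.integral_add measure_def[symmetric])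
    also have "c * q / 2 = y / 4" using q by (simp add: c_def)
    also have "prob A / (2 * c) = prob A * q / y" using q y by (simp add: c_def)
    finally have "y / 4 \<le> prob A * q / y" by linarith
    then have "y\<^sup>2 / (4 * q) \<le> prob A"
      using q y by (simp add: field_simps power2_eq_square)
    then show ?thesis by (simp add: A_def y_def q_def)
  qed
qed

lemma ln_one_minus_le_quadratic:
  fixes x :: real
  assumes "0 \<le> x" "x < 1"
  shows "ln (1 - x) \<le> - x - x\<^sup>2 / 2"
proof -
  let ?g = "\<lambda>x::real. - x - x\<^sup>2 / 2 - ln (1 - x)"
  have "?g 0 \<le> ?g x"
  proof (rule DERIV_nonneg_imp_nondecreasing[OF assms(1)])
    fix z assume z: "0 \<le> z" "z \<le> x"
    then have "z < 1" using assms by simp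
    then have "(?g has_real_derivative z\<^sup>2 / (1 - z)) (at z)"
      by (auto intro!: derivative_eq_intros simp: field_simps power2_eq_square)
    moreover have "0 \<le> z\<^sup>2 / (1 - z)" using \<open>z < 1\<close> by simp
    ultimately show "\<exists>y. (?g has_real_derivative y) (at z) \<and> 0 \<le> y" by blast
  qed
  then show ?thesis by simp
qed

text \<open>
  The moment generating function of \<open>X\<^sup>2 - 1\<close> for a standard Gaussian \<open>X\<close>, finite for \<open>u < 1 / 2\<close>.
\<close>

definition centred_chi_square_mgf :: "real \<Rightarrow> real" where
  "centred_chi_square_mgf u = exp (- u) / sqrt (1 - 2 * u)"

text \<open>
  Up to a constant, \<open>exp (u x\<^sup>2)\<close> times the standard Gaussian density is the density of a
  centred Gaussian with variance \<open>1 / (1 - 2 u)\<close>, whose integral is 1.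
\<close>

lemma (in prob_space) mgf_centred_chi_square:
  assumes D: "distributed M lborel X std_normal_density" and u: "u < 1 / 2"
  shows "integrable M (\<lambda>\<omega>. exp (u * ((X \<omega>)\<^sup>2 - 1)))"
    and "expectation (\<lambda>\<omega>. exp (u * ((X \<omega>)\<^sup>2 - 1))) = centred_chi_square_mgf u"
proof -
  define \<sigma> where "\<sigma> = 1 / sqrt (1 - 2 * u)"
  have \<sigma>: "\<sigma> > 0" and \<sigma>2: "\<sigma>\<^sup>2 = 1 / (1 - 2 * u)"
    using u by (simp_all add: \<sigma>_def power_divide)
  have eq: "std_normal_density x * exp (u * (x\<^sup>2 - 1))
      = exp (- u) * \<sigma> * normal_density 0 \<sigma> x" for x
  proof -
    have "sqrt (2 * pi * \<sigma>\<^sup>2) = sqrt (2 * pi) * \<sigma>" using \<sigma> by (simp add: real_sqrt_mult)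
    moreover have "- x\<^sup>2 / (2 * \<sigma>\<^sup>2) = - x\<^sup>2 / 2 + u * x\<^sup>2"
      using u by (simp add: \<sigma>2 field_simps)
    ultimately have "normal_density 0 \<sigma> x = 1 / (sqrt (2 * pi) * \<sigma>) * exp (- x\<^sup>2 / 2 + u * x\<^sup>2)"
      by (simp add: normal_density_def)
    moreover have "exp (- u) * exp (- x\<^sup>2 / 2 + u * x\<^sup>2) = exp (- x\<^sup>2 / 2) * exp (u * (x\<^sup>2 - 1))"
      by (simp add: exp_add[symmetric] algebra_simps)
    ultimately show ?thesis
      using \<sigma> by (simp add: std_normal_density_def)
  qed
  have "integrable lborel (\<lambda>x. std_normal_density x * exp (u * (x\<^sup>2 - 1)))"
    unfolding eq using \<sigma> by simp
  then show "integrable M (\<lambda>\<omega>. exp (u * ((X \<omega>)\<^sup>2 - 1)))"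
    by (subst (asm) distributed_integrable[OF D]) auto
  have "(\<integral>x. std_normal_density x * exp (u * (x\<^sup>2 - 1)) \<partial>lborel) = exp (- u) * \<sigma>"
    unfolding eq using \<sigma> by simp
  then show "expectation (\<lambda>\<omega>. exp (u * ((X \<omega>)\<^sup>2 - 1))) = centred_chi_square_mgf u"
    by (subst (asm) distributed_integral[OF D]) (auto simp: \<sigma>_def centred_chi_square_mgf_def)
qed

text \<open>
  The logarithm of the generating function is \<open>- u - ln (1 - 2 * u) / 2 = u\<^sup>2 + O(u\<^sup>3)\<close>. Bounds that
  are purely quadratic in \<open>u\<close> turn the product over all weights into a function of the sum of squared
  weights alone.
\<close>

lemma centred_chi_square_mgf_bounds:
  assumes "0 \<le> u" "u \<le> 1 / 4"
  shows "exp (u\<^sup>2) \<le> centred_chi_square_mgf u" "centred_chi_square_mgf u \<le> exp (4 * u\<^sup>2)"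
proof -
  have "sqrt (1 - 2 * u) = exp (ln (1 - 2 * u) / 2)"
    using assms by (simp add: powr_half_sqrt[symmetric] powr_def)
  then have "centred_chi_square_mgf u = exp (- u - ln (1 - 2 * u) / 2)"
    by (simp add: centred_chi_square_mgf_def exp_diff)
  then show "exp (u\<^sup>2) \<le> centred_chi_square_mgf u" "centred_chi_square_mgf u \<le> exp (4 * u\<^sup>2)"
    using ln_one_minus_le_quadratic[of "2 * u"] ln_one_minus_pos_lower_bound[of "2 * u"] assms
    by (simp_all add: power_mult_distrib)
qed

lemma (in prob_space) mgf_weighted_chi_square:
  fixes \<epsilon> :: "'i \<Rightarrow> 'a \<Rightarrow> real"
  assumes fin: "finite I" and ind: "indep_vars (\<lambda>_. borel) \<epsilon> I"
    and dist: "\<And>i. i \<in> I \<Longrightarrow> distributed M lborel (\<epsilon> i) std_normal_density"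
    and u: "\<And>i. i \<in> I \<Longrightarrow> u i < 1 / 2"
  shows "integrable M (\<lambda>\<omega>. exp (\<Sum>i\<in>I. u i * ((\<epsilon> i \<omega>)\<^sup>2 - 1)))"
    and "expectation (\<lambda>\<omega>. exp (\<Sum>i\<in>I. u i * ((\<epsilon> i \<omega>)\<^sup>2 - 1)))
      = (\<Prod>i\<in>I. centred_chi_square_mgf (u i))"
proof -
  let ?X = "\<lambda>i \<omega>. exp (u i * ((\<epsilon> i \<omega>)\<^sup>2 - 1))"
  have indX: "indep_vars (\<lambda>_. borel) ?X I"
    by (rule indep_vars_compose2[OF ind, where Y = "\<lambda>i x. exp (u i * (x\<^sup>2 - 1))"]) simp
  have iX: "integrable M (?X i)" and eX: "expectation (?X i) = centred_chi_square_mgf (u i)"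
    if "i \<in> I" for i using mgf_centred_chi_square[OF dist u] that by auto
  show "integrable M (\<lambda>\<omega>. exp (\<Sum>i\<in>I. u i * ((\<epsilon> i \<omega>)\<^sup>2 - 1)))"
    using indep_vars_integrable[OF fin indX iX] by (simp add: exp_sum fin)
  show "expectation (\<lambda>\<omega>. exp (\<Sum>i\<in>I. u i * ((\<epsilon> i \<omega>)\<^sup>2 - 1)))
      = (\<Prod>i\<in>I. centred_chi_square_mgf (u i))"
    using indep_vars_lebesgue_integral[OF fin indX iX] eX by (simp add: exp_sum fin)
qed

text \<open>
  A nonasymptotic substitute for the central limit theorem: up to its normalisation by the standard
  deviation, the weighted sum \<open>S\<close> exceeds any given level with a probability bounded below uniformly
  in the weights, as long as no single weight dominates. The Paley-Zygmund inequality for \<open>S\<close> itself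
  would only reach small levels. For \<open>exp (t S / sqrt V)\<close> the mean is at least \<open>exp (t\<^sup>2)\<close> and the
  second moment at most \<open>exp (16 t\<^sup>2)\<close>, and exceeding half the mean forces
  \<open>S / sqrt V > t - ln 2 / t \<ge> t - 1\<close>.
\<close>

lemma (in prob_space) weighted_chi_square_upper_deviation:
  fixes \<epsilon> :: "'i \<Rightarrow> 'a \<Rightarrow> real" and w :: "'i \<Rightarrow> real"
  assumes fin: "finite I" and ind: "indep_vars (\<lambda>_. borel) \<epsilon> I"
    and dist: "\<And>i. i \<in> I \<Longrightarrow> distributed M lborel (\<epsilon> i) std_normal_density"
    and V: "V = (\<Sum>i\<in>I. (w i)\<^sup>2)" "V > 0" and t: "t \<ge> 1"
    and w: "\<And>i. i \<in> I \<Longrightarrow> 0 \<le> w i" "\<And>i. i \<in> I \<Longrightarrow> t * w i \<le> sqrt V / 8"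
  shows "exp (- 14 * t\<^sup>2) / 4
    \<le> prob {\<omega> \<in> space M. (t - 1) * sqrt V < (\<Sum>i\<in>I. w i * ((\<epsilon> i \<omega>)\<^sup>2 - 1))}"
proof -
  \<comment> \<open>the normalisation gives \<open>\<Sum>(u i)\<^sup>2 = t\<^sup>2\<close>, and the bound on the weights gives \<open>2 * u i \<le> 1 / 4\<close>\<close>
  define u where "u = (\<lambda>i. t / sqrt V * w i)"
  define Y where "Y = (\<lambda>\<omega>. exp (\<Sum>i\<in>I. u i * ((\<epsilon> i \<omega>)\<^sup>2 - 1)))"
  have [measurable]: "random_variable borel (\<epsilon> i)" if "i \<in> I" for i
    using ind that unfolding indep_vars_def by auto
  have u: "0 \<le> u i" "u i \<le> 1 / 8" if "i \<in> I" for i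
    using w[OF that] t V by (auto simp: u_def field_simps)
  have sum_u: "(\<Sum>i\<in>I. (u i)\<^sup>2) = t\<^sup>2"
  proof -
    have "(\<Sum>i\<in>I. (u i)\<^sup>2) = t\<^sup>2 / V * (\<Sum>i\<in>I. (w i)\<^sup>2)"
      unfolding sum_distrib_left using V(2) by (simp add: u_def power_mult_distrib power_divide)
    then show ?thesis using V by simp
  qed
  have Y2: "(Y \<omega>)\<^sup>2 = exp (\<Sum>i\<in>I. (2 * u i) * ((\<epsilon> i \<omega>)\<^sup>2 - 1))" for \<omega>
    unfolding Y_def by (simp add: exp_double[symmetric] sum_distrib_left mult.assoc)
  have u': "u i < 1 / 2" "2 * u i < 1 / 2" if "i \<in> I" for i using u[OF that] by auto
  have EY: "expectation Y = (\<Prod>i\<in>I. centred_chi_square_mgf (u i))"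
    unfolding Y_def by (rule mgf_weighted_chi_square[OF fin ind dist u'(1)])
  have EY2: "expectation (\<lambda>\<omega>. (Y \<omega>)\<^sup>2) = (\<Prod>i\<in>I. centred_chi_square_mgf (2 * u i))"
    unfolding Y2 by (rule mgf_weighted_chi_square[OF fin ind dist u'(2)])
  have iY2: "integrable M (\<lambda>\<omega>. (Y \<omega>)\<^sup>2)"
    unfolding Y2 by (rule mgf_weighted_chi_square[OF fin ind dist u'(2)])
  have "exp (t\<^sup>2) = (\<Prod>i\<in>I. exp ((u i)\<^sup>2))" by (simp add: sum_u[symmetric] exp_sum fin)
  also have "\<dots> \<le> expectation Y"
    unfolding EY using u by (intro prod_mono) (force intro!: centred_chi_square_mgf_bounds)
  finally have lower: "exp (t\<^sup>2) \<le> expectation Y" .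
  have "expectation (\<lambda>\<omega>. (Y \<omega>)\<^sup>2) \<le> (\<Prod>i\<in>I. exp (4 * (2 * u i)\<^sup>2))"
    unfolding EY2
  proof (intro prod_mono conjI)
    fix i assume "i \<in> I"
    then have "0 \<le> 2 * u i" "2 * u i \<le> 1 / 4" using u[of i] by auto
    from centred_chi_square_mgf_bounds[OF this]
    show "centred_chi_square_mgf (2 * u i) \<le> exp (4 * (2 * u i)\<^sup>2)"
      "0 \<le> centred_chi_square_mgf (2 * u i)"
      using \<open>2 * u i \<le> 1 / 4\<close> by (auto simp: centred_chi_square_mgf_def)
  qed
  also have "\<dots> = exp (16 * t\<^sup>2)"
    by (simp add: exp_sum[symmetric] fin power_mult_distrib sum_distrib_left[symmetric] sum_u)
  finally have upper: "expectation (\<lambda>\<omega>. (Y \<omega>)\<^sup>2) \<le> exp (16 * t\<^sup>2)" .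
  have posY: "0 < expectation Y" using lower by (rule less_le_trans[rotated]) simp
  have posY2: "0 < expectation (\<lambda>\<omega>. (Y \<omega>)\<^sup>2)"
    unfolding EY2 using u fin
    by (intro prod_pos) (force simp: centred_chi_square_mgf_def)
  have rvY: "random_variable borel Y" unfolding Y_def by measurable
  have "exp (- 14 * t\<^sup>2) / 4 = (exp (t\<^sup>2))\<^sup>2 / (4 * exp (16 * t\<^sup>2))"
    by (simp add: exp_double[symmetric] exp_minus exp_diff[symmetric] field_simps exp_add[symmetric])
  also have "\<dots> \<le> (expectation Y)\<^sup>2 / (4 * expectation (\<lambda>\<omega>. (Y \<omega>)\<^sup>2))"
    using lower upper posY posY2 by (intro frac_le power_mono mult_left_mono) auto
  also have "\<dots> \<le> prob {\<omega> \<in> space M. expectation Y / 2 < Y \<omega>}"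
    by (rule paley_zygmund_half[OF rvY iY2 posY])
  also have "\<dots> \<le> prob {\<omega> \<in> space M. (t - 1) * sqrt V < (\<Sum>i\<in>I. w i * ((\<epsilon> i \<omega>)\<^sup>2 - 1))}"
  proof (rule finite_measure_mono)
    show "{\<omega> \<in> space M. (t - 1) * sqrt V < (\<Sum>i\<in>I. w i * ((\<epsilon> i \<omega>)\<^sup>2 - 1))} \<in> events"
      by measurable
    show "{\<omega> \<in> space M. expectation Y / 2 < Y \<omega>}
      \<subseteq> {\<omega> \<in> space M. (t - 1) * sqrt V < (\<Sum>i\<in>I. w i * ((\<epsilon> i \<omega>)\<^sup>2 - 1))}"
    proof safe
      fix \<omega> assume "expectation Y / 2 < Y \<omega>"
      let ?S = "\<Sum>i\<in>I. w i * ((\<epsilon> i \<omega>)\<^sup>2 - 1)"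
      \<comment> \<open>\<open>ln 2\<close> is rounded up to 1\<close>
      have "exp (t\<^sup>2 - 1) \<le> exp (t\<^sup>2) / 2"
        using exp_ge_add_one_self[of 1] by (simp add: exp_diff field_simps)
      also have "\<dots> < Y \<omega>" using lower \<open>expectation Y / 2 < Y \<omega>\<close> by simp
      also have "Y \<omega> = exp (t / sqrt V * ?S)"
        unfolding Y_def u_def by (simp add: sum_distrib_left mult.assoc)
      finally have "t\<^sup>2 - 1 < t / sqrt V * ?S" by simp
      then have *: "(t\<^sup>2 - 1) * sqrt V < t * ?S" using V by (simp add: field_simps)
      have "t * ((t - 1) * sqrt V) \<le> (t\<^sup>2 - 1) * sqrt V"
        using t V by (simp add: power2_eq_square algebra_simps)
      with * have "t * ((t - 1) * sqrt V) < t * ?S" by linarith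
      then show "(t - 1) * sqrt V < ?S" using t by simp
    qed
  qed
  finally show ?thesis .
qed

section \<open>Symmetry of the noise\<close>

lemma (in prob_space) distr_negated_gaussian_vector:
  fixes \<epsilon> :: "'i \<Rightarrow> 'a \<Rightarrow> real"
  assumes ind: "indep_vars (\<lambda>_. borel) \<epsilon> I"
    and dist: "\<And>i. i \<in> I \<Longrightarrow> distributed M lborel (\<epsilon> i) std_normal_density"
  shows "distr M (\<Pi>\<^sub>M i\<in>I. borel) (\<lambda>\<omega>. \<lambda>i\<in>I. - \<epsilon> i \<omega>) = distr M (\<Pi>\<^sub>M i\<in>I. borel) (\<lambda>\<omega>. \<lambda>i\<in>I. \<epsilon> i \<omega>)"
proof (cases "I = {}")
  case True
  then show ?thesis by (simp add: restrict_def)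
next
  case False
  have rv: "random_variable borel (\<epsilon> i)" if "i \<in> I" for i
    using ind that unfolding indep_vars_def by auto
  then have rv': "random_variable borel (\<lambda>\<omega>. - \<epsilon> i \<omega>)" if "i \<in> I" for i using that by simp
  have ind': "indep_vars (\<lambda>_. borel) (\<lambda>i \<omega>. - \<epsilon> i \<omega>) I"
    by (rule indep_vars_compose2[OF ind, where Y = "\<lambda>i x. - x"]) simp
  have "distr M borel (\<lambda>\<omega>. - \<epsilon> i \<omega>) = distr M borel (\<epsilon> i)" if "i \<in> I" for i
  proof -
    have "distributed M lborel (\<lambda>\<omega>. - \<epsilon> i \<omega>) std_normal_density"
      using normal_density_affine[OF dist[OF that], of "-1" 0] by simp
    then have "distr M lborel (\<lambda>\<omega>. - \<epsilon> i \<omega>) = distr M lborel (\<epsilon> i)"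
      using dist[OF that] by (simp add: distributed_distr_eq_density)
    moreover have "distr M borel f = distr M lborel f" for f :: "'a \<Rightarrow> real"
      by (rule distr_cong) auto
    ultimately show ?thesis by simp
  qed
  then show ?thesis
    using indep_vars_iff_distr_eq_PiM'[OF False, where M' = "\<lambda>_. borel" and X = \<epsilon>] ind rv
      indep_vars_iff_distr_eq_PiM'[OF False, where M' = "\<lambda>_. borel" and X = "\<lambda>i \<omega>. - \<epsilon> i \<omega>"] ind' rv'
    by (simp cong: PiM_cong)
qed

text \<open>
  The average of \<open>(\<nu> + x)\<^sup>2\<close> and \<open>(\<nu> - x)\<^sup>2\<close> is \<open>\<nu>\<^sup>2 + x\<^sup>2\<close>, so whenever the pure noise sum exceeds \<open>T\<close>,
  so does the shifted sum for the noise or for its reflection. These two events are equally likely.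
  This is what makes the lower bound hold for every signal.
\<close>

lemma (in prob_space) prob_central_le_twice_noncentral:
  fixes \<epsilon> :: "'i \<Rightarrow> 'a \<Rightarrow> real" and w \<nu> :: "'i \<Rightarrow> real"
  assumes fin: "finite I" and ind: "indep_vars (\<lambda>_. borel) \<epsilon> I"
    and dist: "\<And>i. i \<in> I \<Longrightarrow> distributed M lborel (\<epsilon> i) std_normal_density"
    and w: "\<And>i. i \<in> I \<Longrightarrow> 0 \<le> w i"
  shows "prob {\<omega> \<in> space M. T < (\<Sum>i\<in>I. w i * (\<epsilon> i \<omega>)\<^sup>2)}
    \<le> 2 * prob {\<omega> \<in> space M. T < (\<Sum>i\<in>I. w i * (\<nu> i + \<epsilon> i \<omega>)\<^sup>2)}"
proof -
  have [measurable]: "random_variable borel (\<epsilon> i)" if "i \<in> I" for i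
    using ind that unfolding indep_vars_def by auto
  let ?P = "\<Pi>\<^sub>M i\<in>I. (borel :: real measure)"
  define E where "E = {x \<in> space ?P. T < (\<Sum>i\<in>I. w i * (\<nu> i + x i)\<^sup>2)}"
  have E: "E \<in> sets ?P" unfolding E_def by measurable
  define Ap where "Ap = {\<omega> \<in> space M. T < (\<Sum>i\<in>I. w i * (\<nu> i + \<epsilon> i \<omega>)\<^sup>2)}"
  define Am where "Am = {\<omega> \<in> space M. T < (\<Sum>i\<in>I. w i * (\<nu> i + - \<epsilon> i \<omega>)\<^sup>2)}"
  have ev: "Ap \<in> events" "Am \<in> events" unfolding Ap_def Am_def by measurable
  have "Ap = (\<lambda>\<omega>. \<lambda>i\<in>I. \<epsilon> i \<omega>) -` E \<inter> space M"
    unfolding Ap_def E_def by (auto simp: space_PiM)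
  then have p: "prob Ap = measure (distr M ?P (\<lambda>\<omega>. \<lambda>i\<in>I. \<epsilon> i \<omega>)) E"
    using E by (subst measure_distr) (auto intro!: measurable_restrict)
  have "Am = (\<lambda>\<omega>. \<lambda>i\<in>I. - \<epsilon> i \<omega>) -` E \<inter> space M"
    unfolding Am_def E_def by (auto simp: space_PiM)
  then have "prob Am = measure (distr M ?P (\<lambda>\<omega>. \<lambda>i\<in>I. - \<epsilon> i \<omega>)) E"
    using E by (subst measure_distr) (auto intro!: measurable_restrict)
  with p have same: "prob Am = prob Ap"
    by (simp add: distr_negated_gaussian_vector[OF ind dist])
  have "prob {\<omega> \<in> space M. T < (\<Sum>i\<in>I. w i * (\<epsilon> i \<omega>)\<^sup>2)} \<le> prob (Ap \<union> Am)"
  proof (rule finite_measure_mono)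
    show "{\<omega> \<in> space M. T < (\<Sum>i\<in>I. w i * (\<epsilon> i \<omega>)\<^sup>2)} \<subseteq> Ap \<union> Am"
    proof
      fix \<omega> assume \<omega>: "\<omega> \<in> {\<omega> \<in> space M. T < (\<Sum>i\<in>I. w i * (\<epsilon> i \<omega>)\<^sup>2)}"
      let ?p = "\<Sum>i\<in>I. w i * (\<nu> i + \<epsilon> i \<omega>)\<^sup>2"
      let ?m = "\<Sum>i\<in>I. w i * (\<nu> i + - \<epsilon> i \<omega>)\<^sup>2"
      have "?p + ?m = 2 * (\<Sum>i\<in>I. w i * (\<epsilon> i \<omega>)\<^sup>2) + 2 * (\<Sum>i\<in>I. w i * (\<nu> i)\<^sup>2)"
        unfolding sum_distrib_left sum.distrib[symmetric]
        by (intro sum.cong) (auto simp: power2_eq_square algebra_simps)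
      moreover have "0 \<le> (\<Sum>i\<in>I. w i * (\<nu> i)\<^sup>2)" using w by (intro sum_nonneg) auto
      moreover have "T < (\<Sum>i\<in>I. w i * (\<epsilon> i \<omega>)\<^sup>2)" using \<omega> by simp
      ultimately have "T < ?p \<or> T < ?m" by linarith
      then show "\<omega> \<in> Ap \<union> Am" using \<omega> by (auto simp: Ap_def Am_def)
    qed
  qed (use ev in auto)
  also have "\<dots> \<le> prob Ap + prob Am" using ev by (rule measure_Un_le)
  finally show ?thesis using same by (simp add: Ap_def)
qed

section \<open>Sums of powers\<close>

text \<open>
  Induction on \<open>m\<close>: with \<open>x = m + 1\<close>, the ratio \<open>(x / m) powr \<theta>\<close> is at most
  \<open>sqrt (x / m) \<le> 1 + 1 / (2 m)\<close>. The restriction \<open>\<theta> \<le> 1 / 2\<close> makes the constant 2 uniform in \<open>\<theta>\<close>.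
\<close>

lemma sum_powr_minus_le:
  fixes \<theta> :: real
  assumes "0 \<le> \<theta>" "\<theta> \<le> 1 / 2"
  shows "(\<Sum>i=1..m. real i powr (- \<theta>)) \<le> 2 * real m powr (1 - \<theta>)"
proof (induction m)
  case 0
  then show ?case by simp
next
  case (Suc m)
  define x where "x = real (Suc m)"
  have x: "x > 0" and powr_x: "x powr (1 - \<theta>) = x * x powr (- \<theta>)"
    using powr_mult_base[of x "- \<theta>"] by (simp_all add: x_def)
  have "2 * real m powr (1 - \<theta>) \<le> (2 * real m + 1) * x powr (- \<theta>)"
  proof (cases "m = 0")
    case False
    then have m: "real m > 0" by simp
    have "(x / real m) powr \<theta> \<le> (x / real m) powr (1 / 2)"
      using assms m by (intro powr_mono) (auto simp: x_def field_simps)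
    also have "\<dots> = sqrt (x / real m)" using m x by (simp add: powr_half_sqrt)
    also have "\<dots> \<le> 1 + 1 / (2 * real m)"
      using m by (intro real_le_lsqrt) (auto simp: x_def power2_eq_square field_simps)
    finally have "(x / real m) powr \<theta> \<le> 1 + 1 / (2 * real m)" .
    then have "2 * real m * (x / real m) powr \<theta> * x powr (- \<theta>)
        \<le> 2 * real m * (1 + 1 / (2 * real m)) * x powr (- \<theta>)"
      using m by (intro mult_right_mono mult_left_mono) auto
    moreover have "(x / real m) powr \<theta> * x powr (- \<theta>) = real m powr (- \<theta>)"
      using m x by (simp add: powr_divide powr_minus field_simps)
    moreover have "real m * real m powr (- \<theta>) = real m powr (1 - \<theta>)"
      using powr_mult_base[of "real m" "- \<theta>"] by simp
    moreover have "2 * real m * (1 + 1 / (2 * real m)) = 2 * real m + 1"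
      using m by (simp add: field_simps)
    ultimately show ?thesis by (metis mult.assoc)
  qed simp
  moreover have "(\<Sum>i=1..Suc m. real i powr (- \<theta>)) = (\<Sum>i=1..m. real i powr (- \<theta>)) + x powr (- \<theta>)"
    by (simp add: x_def)
  ultimately have "(\<Sum>i=1..Suc m. real i powr (- \<theta>)) \<le> (2 * real m + 2) * x powr (- \<theta>)"
    using Suc.IH by (simp add: algebra_simps)
  also have "\<dots> = 2 * x powr (1 - \<theta>)" by (simp add: powr_x) (simp add: x_def algebra_simps)
  finally show ?case by (simp add: x_def)
qed

text \<open>
  At least half of the indices satisfy \<open>i \<ge> m / 2\<close>.
\<close>

lemma sum_powr_ge:
  fixes q :: real
  assumes "0 \<le> q"
  shows "(real m / 2) powr (q + 1) \<le> (\<Sum>i=1..m. real i powr q)"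
proof -
  let ?J = "{Suc (m div 2)..m}"
  have card: "real m / 2 \<le> real (card ?J)"
    by simp
  have "(real m / 2) powr (q + 1) = real m / 2 * (real m / 2) powr q"
    using powr_mult_base[of "real m / 2" q] by (simp add: add.commute)
  also have "\<dots> \<le> real (card ?J) * (real m / 2) powr q"
    using card by (intro mult_right_mono) auto
  also have "\<dots> = (\<Sum>i\<in>?J. (real m / 2) powr q)" by simp
  also have "\<dots> \<le> (\<Sum>i\<in>?J. real i powr q)"
    using assms by (intro sum_mono powr_mono2) auto
  also have "\<dots> \<le> (\<Sum>i=1..m. real i powr q)" by (intro sum_mono2) auto
  finally show ?thesis .
qed

section \<open>The loss at the stopping time\<close>

lemma smoothed_residual_sq_antimono:
  assumes "m \<le> n"
  shows "smoothed_residual_sq \<alpha> D lam Y n \<le> smoothed_residual_sq \<alpha> D lam Y m"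
  unfolding smoothed_residual_sq_def using assms by (intro sum_mono2) auto

lemma stopping_time_le_iff:
  assumes "0 \<le> \<kappa>"
  shows "stopping_time \<alpha> D lam \<kappa> Y \<le> m \<longleftrightarrow> smoothed_residual_sq \<alpha> D lam Y m \<le> \<kappa>"
proof
  let ?S = "{m. smoothed_residual_sq \<alpha> D lam Y m \<le> \<kappa>}"
  have "D \<in> ?S" using assms by (simp add: smoothed_residual_sq_def)
  then have "stopping_time \<alpha> D lam \<kappa> Y \<in> ?S"
    unfolding stopping_time_def by (intro Inf_nat_def1) auto
  moreover assume "stopping_time \<alpha> D lam \<kappa> Y \<le> m"
  ultimately show "smoothed_residual_sq \<alpha> D lam Y m \<le> \<kappa>"
    using smoothed_residual_sq_antimono order_trans by blast
next
  assume "smoothed_residual_sq \<alpha> D lam Y m \<le> \<kappa>"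
  then show "stopping_time \<alpha> D lam \<kappa> Y \<le> m"
    unfolding stopping_time_def by (intro cInf_lower) auto
qed

text \<open>
  Coordinate \<open>i\<close> is estimated exactly when the rule has not stopped by \<open>i - 1\<close>, in which case its
  error is pure noise; otherwise its error is the signal itself. Since the stopping time no longer
  occurs, the loss is visibly measurable.
\<close>

lemma stopped_loss_eq:
  assumes "0 \<le> \<kappa>" and lam: "\<And>i. i \<in> {1..D} \<Longrightarrow> 0 < lam i"
    and Y: "Y = observation lam mu \<delta> eps \<omega>"
  shows "(L2_set (\<lambda>i. svd_estimator lam Y (stopping_time \<alpha> D lam \<kappa> Y) i - mu i) {1..D})\<^sup>2
    = (\<Sum>i=1..D. if \<kappa> < smoothed_residual_sq \<alpha> D lam Y (i - 1)
        then \<delta>\<^sup>2 * (inverse (lam i))\<^sup>2 * (eps i \<omega>)\<^sup>2 else (mu i)\<^sup>2)"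
proof -
  let ?\<tau> = "stopping_time \<alpha> D lam \<kappa> Y"
  have "(L2_set (\<lambda>i. svd_estimator lam Y ?\<tau> i - mu i) {1..D})\<^sup>2
      = (\<Sum>i=1..D. (svd_estimator lam Y ?\<tau> i - mu i)\<^sup>2)"
    by (simp add: L2_set_def sum_nonneg)
  also have "\<dots> = (\<Sum>i=1..D. if \<kappa> < smoothed_residual_sq \<alpha> D lam Y (i - 1)
        then \<delta>\<^sup>2 * (inverse (lam i))\<^sup>2 * (eps i \<omega>)\<^sup>2 else (mu i)\<^sup>2)"
  proof (intro sum.cong refl)
    fix i assume i: "i \<in> {1..D}"
    have "i \<le> ?\<tau> \<longleftrightarrow> \<not> ?\<tau> \<le> i - 1" using i by auto
    also have "\<dots> \<longleftrightarrow> \<kappa> < smoothed_residual_sq \<alpha> D lam Y (i - 1)"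
      by (simp add: stopping_time_le_iff[OF assms(1)] not_le)
    finally have "i \<le> ?\<tau> \<longleftrightarrow> \<kappa> < smoothed_residual_sq \<alpha> D lam Y (i - 1)" .
    moreover have "inverse (lam i) * Y i - mu i = \<delta> * inverse (lam i) * eps i \<omega>"
      using lam[OF i] by (simp add: Y observation_def field_simps)
    ultimately show "(svd_estimator lam Y ?\<tau> i - mu i)\<^sup>2
      = (if \<kappa> < smoothed_residual_sq \<alpha> D lam Y (i - 1)
        then \<delta>\<^sup>2 * (inverse (lam i))\<^sup>2 * (eps i \<omega>)\<^sup>2 else (mu i)\<^sup>2)"
      by (simp add: svd_estimator_def power_mult_distrib)
  qed
  finally show ?thesis .
qed

lemma (in prob_space) std_normal_square:
  assumes D: "distributed M lborel X std_normal_density"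
  shows "integrable M (\<lambda>\<omega>. (X \<omega>)\<^sup>2)" "expectation (\<lambda>\<omega>. (X \<omega>)\<^sup>2) = 1"
proof -
  show "integrable M (\<lambda>\<omega>. (X \<omega>)\<^sup>2)"
    using distributed_integrable[OF D, of "\<lambda>x. x\<^sup>2"] integrable_std_normal_moment[of 2] by simp
  show "expectation (\<lambda>\<omega>. (X \<omega>)\<^sup>2) = 1"
    using distributed_integral[OF D, of "\<lambda>x. x\<^sup>2"] integral_std_normal_moment_even[of 1] by simp
qed

text \<open>
  If the residual at \<open>m\<close> still exceeds \<open>\<kappa>\<close>, then the first \<open>m\<close> coordinates are all estimated and
  contribute \<open>\<delta>\<^sup>2 (lam i)^(-2) (eps i)\<^sup>2\<close> each. That event depends on the noise beyond \<open>m\<close> only, hence it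
  is independent of these contributions, and the expectation of the product factorises.
\<close>

lemma stopped_risk_ge:
  assumes noise: "standard_gaussian_noise M D eps" and \<kappa>: "0 \<le> \<kappa>" and m: "m \<le> D"
    and lam: "\<And>i. i \<in> {1..D} \<Longrightarrow> 0 < lam i"
  shows "\<delta>\<^sup>2 * (\<Sum>i=1..m. (inverse (lam i))\<^sup>2) *
      measure M {\<omega> \<in> space M. \<kappa> < smoothed_residual_sq \<alpha> D lam (observation lam mu \<delta> eps \<omega>) m}
    \<le> stopped_risk M \<alpha> D lam mu \<delta> eps \<kappa>"
proof -
  interpret prob_space M using noise by (simp add: standard_gaussian_noise_def)
  have ind: "indep_vars (\<lambda>_. borel) eps {1..D}"
    and dist: "\<And>i. i \<in> {1..D} \<Longrightarrow> distributed M lborel (eps i) std_normal_density"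
    using noise by (auto simp: standard_gaussian_noise_def)
  have [measurable]: "random_variable borel (eps i)" if "i \<in> {1..D}" for i
    using ind that unfolding indep_vars_def by auto
  let ?R = "\<lambda>n \<omega>. smoothed_residual_sq \<alpha> D lam (observation lam mu \<delta> eps \<omega>) n"
  have R[measurable]: "random_variable borel (?R n)" for n
    unfolding smoothed_residual_sq_def observation_def by measurable auto
  let ?f = "\<lambda>i \<omega>. if \<kappa> < ?R (i - 1) \<omega> then \<delta>\<^sup>2 * (inverse (lam i))\<^sup>2 * (eps i \<omega>)\<^sup>2 else (mu i)\<^sup>2"
  define B where "B = {\<omega> \<in> space M. \<kappa> < ?R m \<omega>}"
  have B[measurable]: "B \<in> events" unfolding B_def by measurable
  have risk: "stopped_risk M \<alpha> D lam mu \<delta> eps \<kappa> = expectation (\<lambda>\<omega>. \<Sum>i=1..D. ?f i \<omega>)"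
    unfolding stopped_risk_def Let_def
    by (rule Bochner_Integration.integral_cong[OF refl stopped_loss_eq[OF \<kappa> lam refl]])
  have iB: "integrable M (\<lambda>\<omega>. indicator B \<omega> * (eps i \<omega>)\<^sup>2)"
    and EB: "expectation (\<lambda>\<omega>. indicator B \<omega> * (eps i \<omega>)\<^sup>2) = prob B" if i: "i \<in> {1..m}" for i
  proof -
    let ?J = "{m+1..D}"
    \<comment> \<open>\<open>g\<close> is the indicator of the event as a function of the noise coordinates beyond \<open>m\<close>\<close>
    define g where "g = (\<lambda>x. indicat_real {x. \<kappa> < (\<Sum>j\<in>?J. lam j powr (2 * \<alpha>) * (lam j * mu j + \<delta> * x j)\<^sup>2)} x)"
    have iD: "i \<in> {1..D}" using i m by auto
    have "indep_var (PiM ?J (\<lambda>_. borel)) (\<lambda>\<omega>. restrict (\<lambda>j. eps j \<omega>) ?J)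
        (PiM {i} (\<lambda>_. borel)) (\<lambda>\<omega>. restrict (\<lambda>j. eps j \<omega>) {i})"
      using i m by (intro indep_var_restrict[OF ind]) auto
    then have "indep_var borel (g \<circ> (\<lambda>\<omega>. restrict (\<lambda>j. eps j \<omega>) ?J))
        borel ((\<lambda>x. (x i)\<^sup>2) \<circ> (\<lambda>\<omega>. restrict (\<lambda>j. eps j \<omega>) {i}))"
    proof (rule indep_var_compose)
      show "g \<in> borel_measurable (PiM ?J (\<lambda>_. borel))"
        unfolding g_def indicator_def by measurable
      show "(\<lambda>x. (x i)\<^sup>2) \<in> borel_measurable (PiM {i} (\<lambda>_. borel :: real measure))"
        by measurable
    qed
    then have indep: "indep_var borel (\<lambda>\<omega>. g (restrict (\<lambda>j. eps j \<omega>) ?J)) borel (\<lambda>\<omega>. (eps i \<omega>)\<^sup>2)"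
      by (simp add: comp_def)
    have gB: "g (restrict (\<lambda>j. eps j \<omega>) ?J) = indicator B \<omega>" if "\<omega> \<in> space M" for \<omega>
      using that by (simp add: g_def B_def smoothed_residual_sq_def observation_def indicator_def)
    have iB': "integrable M (indicator B :: 'a \<Rightarrow> real)"
      using B by (simp add: integrable_indicator_iff emeasure_eq_measure)
    then have ig: "integrable M (\<lambda>\<omega>. g (restrict (\<lambda>j. eps j \<omega>) ?J))"
      by (subst Bochner_Integration.integrable_cong[OF refl gB])
    note sq = std_normal_square[OF dist[OF iD]]
    show "integrable M (\<lambda>\<omega>. indicator B \<omega> * (eps i \<omega>)\<^sup>2)"
      using indep_var_integrable[OF indep ig sq(1)]
      by (rule iffD1[OF Bochner_Integration.integrable_cong[OF refl], rotated]) (simp only: gB)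
    have "expectation (\<lambda>\<omega>. indicator B \<omega> * (eps i \<omega>)\<^sup>2)
        = expectation (\<lambda>\<omega>. g (restrict (\<lambda>j. eps j \<omega>) ?J) * (eps i \<omega>)\<^sup>2)"
      by (rule Bochner_Integration.integral_cong[OF refl]) (simp only: gB)
    also have "\<dots> = expectation (\<lambda>\<omega>. g (restrict (\<lambda>j. eps j \<omega>) ?J))"
      using indep_var_lebesgue_integral[OF indep ig sq(1)] sq(2) by simp
    also have "\<dots> = expectation (indicator B)"
      by (rule Bochner_Integration.integral_cong[OF refl]) (simp only: gB)
    finally show "expectation (\<lambda>\<omega>. indicator B \<omega> * (eps i \<omega>)\<^sup>2) = prob B" using B by simp
  qed
  have "\<delta>\<^sup>2 * (\<Sum>i=1..m. (inverse (lam i))\<^sup>2) * prob B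
      = (\<Sum>i=1..m. \<delta>\<^sup>2 * (inverse (lam i))\<^sup>2 * expectation (\<lambda>\<omega>. indicator B \<omega> * (eps i \<omega>)\<^sup>2))"
    by (simp only: sum_distrib_left sum_distrib_right EB cong: sum.cong)
  also have "\<dots> = expectation (\<lambda>\<omega>. \<Sum>i=1..m. \<delta>\<^sup>2 * (inverse (lam i))\<^sup>2 * (indicator B \<omega> * (eps i \<omega>)\<^sup>2))"
    using iB by (subst Bochner_Integration.integral_sum) auto
  also have "\<dots> \<le> expectation (\<lambda>\<omega>. \<Sum>i=1..D. ?f i \<omega>)"
  proof (rule integral_mono)
    show "integrable M (\<lambda>\<omega>. \<Sum>i=1..m. \<delta>\<^sup>2 * (inverse (lam i))\<^sup>2 * (indicator B \<omega> * (eps i \<omega>)\<^sup>2))"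
      using iB by (intro Bochner_Integration.integrable_sum integrable_mult_right) auto
    show "integrable M (\<lambda>\<omega>. \<Sum>i=1..D. ?f i \<omega>)"
    proof (rule Bochner_Integration.integrable_sum)
      fix i assume i: "i \<in> {1..D}"
      show "integrable M (?f i)"
      proof (rule Bochner_Integration.integrable_bound)
        \<comment> \<open>integrability matters: the expectation of a non-integrable loss would be 0 by convention\<close>
        show "integrable M (\<lambda>\<omega>. \<delta>\<^sup>2 * (inverse (lam i))\<^sup>2 * (eps i \<omega>)\<^sup>2 + (mu i)\<^sup>2)"
          using std_normal_square[OF dist[OF i]] by simp
        show "random_variable borel (?f i)" using i by measurable
      qed auto
    qed
    fix \<omega> assume \<omega>: "\<omega> \<in> space M"
    have "(\<Sum>i=1..m. \<delta>\<^sup>2 * (inverse (lam i))\<^sup>2 * (indicator B \<omega> * (eps i \<omega>)\<^sup>2)) \<le> (\<Sum>i=1..m. ?f i \<omega>)"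
    proof (rule sum_mono)
      fix i assume "i \<in> {1..m}"
      then have "?R m \<omega> \<le> ?R (i - 1) \<omega>" by (intro smoothed_residual_sq_antimono) auto
      then show "\<delta>\<^sup>2 * (inverse (lam i))\<^sup>2 * (indicator B \<omega> * (eps i \<omega>)\<^sup>2) \<le> ?f i \<omega>"
        by (cases "\<omega> \<in> B") (auto simp: B_def)
    qed
    also have "\<dots> \<le> (\<Sum>i=1..D. ?f i \<omega>)" using m by (intro sum_mono2) auto
    finally show "(\<Sum>i=1..m. \<delta>\<^sup>2 * (inverse (lam i))\<^sup>2 * (indicator B \<omega> * (eps i \<omega>)\<^sup>2))
      \<le> (\<Sum>i=1..D. ?f i \<omega>)" .
  qed
  finally show ?thesis unfolding risk B_def .
qed

section \<open>The stopping time is large with positive probability\<close>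

text \<open>
  Discarding the first \<open>m\<close> summands lowers the mean of the noise sum by at most \<open>a * s\<close>, and the
  threshold lies at most \<open>b * s\<close> above the full mean, so the tail has to exceed its mean by
  \<open>(a + b) * s\<close>. This is a bounded number of standard deviations, because the tail keeps at least
  half of the variance \<open>s\<^sup>2\<close> once \<open>s\<close> is large. The value of \<open>t\<close> makes \<open>(t - 1) * sqrt V\<close> at least
  \<open>(a + b) * s\<close> when \<open>sqrt V \<ge> s / 2\<close>.
\<close>

lemma prob_tail_exceeds_threshold:
  fixes w \<nu> :: "nat \<Rightarrow> real"
  assumes noise: "standard_gaussian_noise M D eps" and m: "m \<le> D"
    and w: "\<And>i. i \<in> {1..D} \<Longrightarrow> 0 \<le> w i \<and> w i \<le> 1"
    and s: "s = sqrt (2 * (\<Sum>i=1..D. (w i)\<^sup>2))"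
    and head: "(\<Sum>i=1..m. w i) \<le> a * s" and T: "T \<le> (\<Sum>i=1..D. w i) + b * s"
    and "0 \<le> a" "0 \<le> b" and t: "t = 2 * (a + b) + 1" and large: "16 * t \<le> s"
  shows "exp (- 14 * t\<^sup>2) / 8
    \<le> measure M {\<omega> \<in> space M. T < (\<Sum>i=m+1..D. w i * (\<nu> i + eps i \<omega>)\<^sup>2)}"
proof -
  interpret prob_space M using noise by (simp add: standard_gaussian_noise_def)
  let ?I = "{m+1..D}"
  have split: "sum h {1..D} = sum h {1..m} + sum h ?I" for h :: "nat \<Rightarrow> real"
    using m sum.ub_add_nat[of 1 m h "D - m"] by simp
  have ind: "indep_vars (\<lambda>_. borel) eps ?I"
    using noise by (auto simp: standard_gaussian_noise_def intro: indep_vars_subset)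
  have dist: "distributed M lborel (eps i) std_normal_density" if "i \<in> ?I" for i
    using noise that by (auto simp: standard_gaussian_noise_def)
  have [measurable]: "random_variable borel (eps i)" if "i \<in> ?I" for i
    using ind that unfolding indep_vars_def by auto
  have t1: "t \<ge> 1" using assms(7,8) t by simp
  have spos: "s > 0" using large t1 by simp
  define V where "V = (\<Sum>i\<in>?I. (w i)\<^sup>2)"
  have s2: "s\<^sup>2 = 2 * (\<Sum>i=1..D. (w i)\<^sup>2)" by (simp add: s sum_nonneg)
  have "(\<Sum>i=1..m. (w i)\<^sup>2) \<le> (\<Sum>i=1..m. w i)"
  proof (rule sum_mono)
    fix i assume "i \<in> {1..m}"
    then show "(w i)\<^sup>2 \<le> w i" using w[of i] m
      by (simp add: power2_eq_square mult_left_le)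
  qed
  moreover have "a * s \<le> s / 4 * s" using large t assms(7,8) spos by (intro mult_right_mono) auto
  ultimately have V4: "s\<^sup>2 / 4 \<le> V"
    using s2 head split[of "\<lambda>i. (w i)\<^sup>2"] by (simp add: V_def power2_eq_square)
  have "sqrt (s\<^sup>2 / 4) \<le> sqrt V" using V4 by simp
  then have sV: "s / 2 \<le> sqrt V" using spos by (simp add: real_sqrt_divide)
  have Vpos: "V > 0" using V4 spos by (simp add: less_le_trans[OF _ V4])
  have "exp (- 14 * t\<^sup>2) / 4 \<le> prob {\<omega> \<in> space M. (t - 1) * sqrt V < (\<Sum>i\<in>?I. w i * ((eps i \<omega>)\<^sup>2 - 1))}"
  proof (rule weighted_chi_square_upper_deviation[OF _ ind dist V_def Vpos t1])
    fix i assume "i \<in> ?I"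
    then have wi: "0 \<le> w i" "w i \<le> 1" using w[of i] by auto
    then show "0 \<le> w i" by simp
    have "t * w i \<le> t" using wi t1 by (simp add: mult_left_le)
    then show "t * w i \<le> sqrt V / 8" using large sV by simp
  qed auto
  also have "\<dots> \<le> prob {\<omega> \<in> space M. T < (\<Sum>i\<in>?I. w i * (eps i \<omega>)\<^sup>2)}"
  proof (rule finite_measure_mono)
    show "{\<omega> \<in> space M. T < (\<Sum>i\<in>?I. w i * (eps i \<omega>)\<^sup>2)} \<in> events" by measurable
    have "(t - 1) * (s / 2) \<le> (t - 1) * sqrt V" using sV t1 by (intro mult_left_mono) auto
    moreover have "(t - 1) * (s / 2) = (a + b) * s" by (simp add: t field_simps)
    ultimately have "(a + b) * s \<le> (t - 1) * sqrt V" by linarith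
    then have "T \<le> (t - 1) * sqrt V + (\<Sum>i\<in>?I. w i)"
      using T head split[of w] by (simp add: algebra_simps)
    then show "{\<omega> \<in> space M. (t - 1) * sqrt V < (\<Sum>i\<in>?I. w i * ((eps i \<omega>)\<^sup>2 - 1))}
      \<subseteq> {\<omega> \<in> space M. T < (\<Sum>i\<in>?I. w i * (eps i \<omega>)\<^sup>2)}"
      by (auto simp: right_diff_distrib sum_subtractf)
  qed
  also have "\<dots> \<le> 2 * prob {\<omega> \<in> space M. T < (\<Sum>i\<in>?I. w i * (\<nu> i + eps i \<omega>)\<^sup>2)}"
    using w by (intro prob_central_le_twice_noncentral[OF _ ind dist]) auto
  finally show ?thesis by simp
qed

section \<open>Choice of the truncation level\<close>

text \<open>
  The level is of order \<open>s powr (1 / (1 - \<theta>))\<close> with \<open>\<theta> = 2 * \<alpha> * p\<close>, which keeps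
  the head sum \<open>\<Sum>i\<le>m. i powr (- \<theta>)\<close>, comparable to \<open>m powr (1 - \<theta>)\<close>, of order \<open>s\<close>. The
  noise variance \<open>\<Sum>i\<le>m. i powr (2 * p)\<close> of the first \<open>m\<close> coordinates is then of order
  \<open>m powr (2 * p + 1)\<close>, which is the claimed rate. All constants are uniform in \<open>\<alpha>\<close> because
  \<open>\<alpha> \<le> \<alpha>_max\<close> and \<open>\<theta> \<le> 1 / 2\<close>.
\<close>

lemma exists_truncation_level:
  assumes lam: "singular_values D lam" "polynomial_decay p C_A D lam"
    and p: "0 \<le> p" "0 \<le> \<alpha>" "\<alpha> \<le> \<alpha>_max" "\<alpha> * p \<le> 1 / 4" and C_A: "1 \<le> C_A"
    and s: "s = s_dim \<alpha> D lam" "2 \<le> s"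
  shows "\<exists>m\<le>D. (\<Sum>i=1..m. lam i powr (2 * \<alpha>)) \<le> 2 * C_A powr (2 * \<alpha>_max) * s \<and>
    (1 / 8) powr (2 * p + 1) / C_A\<^sup>2 * s powr ((2 * p + 1) / (1 - 2 * \<alpha> * p))
      \<le> (\<Sum>i=1..m. (inverse (lam i))\<^sup>2)"
proof -
  have pos: "0 < lam i" "lam i \<le> 1" if "i \<in> {1..D}" for i
    using lam(1) that by (auto simp: singular_values_def)
  have up: "lam i \<le> C_A * real i powr (- p)" if "i \<in> {1..D}" for i
    using lam(2) that by (auto simp: polynomial_decay_def)
  define \<theta> where "\<theta> = 2 * \<alpha> * p"
  have \<theta>: "0 \<le> \<theta>" "\<theta> \<le> 1 / 2" using p by (auto simp: \<theta>_def)
  define x where "x = s powr (1 / (1 - \<theta>))"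
  \<comment> \<open>the factor \<open>1 / 2\<close> ensures \<open>m \<le> D\<close>, since \<open>x \<le> s\<^sup>2 \<le> 2 * D\<close>\<close>
  define m where "m = nat \<lfloor>x / 2\<rfloor>"
  have "s\<^sup>2 = 2 * (\<Sum>i=1..D. lam i powr (4 * \<alpha>))" by (simp add: s(1) s_dim_def sum_nonneg)
  also have "\<dots> \<le> 2 * (\<Sum>i=1..D. 1)"
    using pos p by (intro mult_left_mono sum_mono powr_le1) (auto simp: less_imp_le)
  finally have sD: "s\<^sup>2 \<le> 2 * real D" by simp
  have exponent: "1 \<le> 1 / (1 - \<theta>)" "1 / (1 - \<theta>) \<le> 2" using \<theta> by (auto simp: field_simps)
  have "s powr 1 \<le> x" unfolding x_def using exponent s(2) by (intro powr_mono) auto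
  then have x2: "2 \<le> x" using s(2) by simp
  have "x \<le> s powr 2" unfolding x_def using exponent s(2) by (intro powr_mono) auto
  also have "s powr 2 = s\<^sup>2" using s(2) by simp
  finally have "x \<le> 2 * real D" using sD by simp
  then have mD: "m \<le> D" unfolding m_def by linarith
  have "1 \<le> \<lfloor>x / 2\<rfloor>" using x2 by simp
  then have m_le: "real m \<le> x" and m_ge: "x / 4 \<le> real m" unfolding m_def using x2 by linarith+
  have "(\<Sum>i=1..m. lam i powr (2 * \<alpha>)) \<le> (\<Sum>i=1..m. C_A powr (2 * \<alpha>_max) * real i powr (- \<theta>))"
  proof (rule sum_mono)
    fix i assume "i \<in> {1..m}"
    then have i: "i \<in> {1..D}" using mD by auto
    have "lam i powr (2 * \<alpha>) \<le> (C_A * real i powr (- p)) powr (2 * \<alpha>)"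
      using pos[OF i] up[OF i] p by (intro powr_mono2) auto
    also have "\<dots> = C_A powr (2 * \<alpha>) * real i powr (- \<theta>)"
      using C_A by (simp add: powr_mult powr_powr \<theta>_def mult_ac)
    also have "\<dots> \<le> C_A powr (2 * \<alpha>_max) * real i powr (- \<theta>)"
      using C_A p by (intro mult_right_mono powr_mono) auto
    finally show "lam i powr (2 * \<alpha>) \<le> C_A powr (2 * \<alpha>_max) * real i powr (- \<theta>)" .
  qed
  also have "\<dots> \<le> C_A powr (2 * \<alpha>_max) * (2 * real m powr (1 - \<theta>))"
    unfolding sum_distrib_left[symmetric] using sum_powr_minus_le[OF \<theta>] by (intro mult_left_mono) auto
  also have "\<dots> \<le> C_A powr (2 * \<alpha>_max) * (2 * x powr (1 - \<theta>))"
    using m_le \<theta> by (intro mult_left_mono powr_mono2) auto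
  also have "x powr (1 - \<theta>) = s" using s(2) \<theta> by (simp add: x_def powr_powr)
  finally have head: "(\<Sum>i=1..m. lam i powr (2 * \<alpha>)) \<le> 2 * C_A powr (2 * \<alpha>_max) * s" by simp
  have "s powr ((2 * p + 1) / (1 - 2 * \<alpha> * p)) = x powr (2 * p + 1)"
    by (simp add: x_def powr_powr \<theta>_def)
  then have "(1 / 8) powr (2 * p + 1) / C_A\<^sup>2 * s powr ((2 * p + 1) / (1 - 2 * \<alpha> * p))
      = (x / 8) powr (2 * p + 1) / C_A\<^sup>2"
    using x2 by (simp add: powr_divide)
  also have "\<dots> \<le> (real m / 2) powr (2 * p + 1) / C_A\<^sup>2"
    using m_ge x2 p by (intro divide_right_mono powr_mono2) auto
  also have "\<dots> \<le> (\<Sum>i=1..m. real i powr (2 * p)) / C_A\<^sup>2"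
    using sum_powr_ge[of "2 * p" m] p by (intro divide_right_mono) auto
  also have "\<dots> \<le> (\<Sum>i=1..m. (inverse (lam i))\<^sup>2)"
    unfolding sum_divide_distrib
  proof (rule sum_mono)
    fix i assume "i \<in> {1..m}"
    then have i: "i \<in> {1..D}" using mD by auto
    have "inverse (C_A * real i powr (- p)) \<le> inverse (lam i)"
      using up[OF i] pos[OF i] by (intro le_imp_inverse_le) auto
    then have "(inverse (C_A * real i powr (- p)))\<^sup>2 \<le> (inverse (lam i))\<^sup>2"
      using C_A i by (intro power_mono) auto
    moreover have "(inverse (C_A * real i powr (- p)))\<^sup>2 = real i powr (2 * p) / C_A\<^sup>2"
      using i by (simp add: powr_minus power_mult_distrib powr_add[symmetric] power2_eq_square divide_inverse)
    ultimately show "real i powr (2 * p) / C_A\<^sup>2 \<le> (inverse (lam i))\<^sup>2" by simp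
  qed
  finally show ?thesis using mD head by blast
qed

text \<open>
  The condition \<open>\<alpha> * p \<le> 1 / 4\<close> is what makes \<open>s_dim\<close> diverge with the dimension: the summand
  \<open>lam i powr (4 * \<alpha>)\<close> decays no faster than \<open>1 / i\<close>. The divergence is uniform in \<open>\<alpha>\<close> and \<open>lam\<close>.
\<close>

lemma harm_le_s_dim_sq:
  assumes decay: "polynomial_decay p C_A D lam"
    and p: "0 \<le> \<alpha>" "\<alpha> \<le> \<alpha>_max" "\<alpha> * p \<le> 1 / 4" and C_A: "1 \<le> C_A"
  shows "2 * C_A powr (- 4 * \<alpha>_max) * harm D \<le> (s_dim \<alpha> D lam)\<^sup>2"
proof -
  have "C_A powr (- 4 * \<alpha>_max) * harm D \<le> (\<Sum>i=1..D. lam i powr (4 * \<alpha>))"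
    unfolding harm_def sum_distrib_left
  proof (rule sum_mono)
    fix i assume i: "i \<in> {1..D}"
    have "C_A powr (- 4 * \<alpha>_max) * inverse (real i) \<le> C_A powr (- 4 * \<alpha>) * real i powr (- 4 * \<alpha> * p)"
    proof (rule mult_mono)
      show "C_A powr (- 4 * \<alpha>_max) \<le> C_A powr (- 4 * \<alpha>)" using C_A p by (intro powr_mono) auto
      have "real i powr (- 1) \<le> real i powr (- 4 * \<alpha> * p)"
        using i p by (intro powr_mono) auto
      then show "inverse (real i) \<le> real i powr (- 4 * \<alpha> * p)"
        using i by (simp add: powr_minus)
    qed auto
    also have "\<dots> = (C_A powr (- 1) * real i powr (- p)) powr (4 * \<alpha>)"
      by (simp only: powr_mult powr_powr powr_ge_zero) (simp add: mult_ac)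
    also have "\<dots> \<le> lam i powr (4 * \<alpha>)"
      using decay i p C_A by (intro powr_mono2) (auto simp: polynomial_decay_def powr_minus)
    finally show "C_A powr (- 4 * \<alpha>_max) * inverse (real i) \<le> lam i powr (4 * \<alpha>)" .
  qed
  moreover have "(s_dim \<alpha> D lam)\<^sup>2 = 2 * (\<Sum>i=1..D. lam i powr (4 * \<alpha>))"
    by (simp add: s_dim_def sum_nonneg)
  ultimately show ?thesis by simp
qed

section \<open>The lower bound\<close>

theorem proposition4p1:
  fixes p C_A C_\<kappa> \<alpha>_max :: real
  assumes "p \<ge> 0" and "C_A \<ge> 1" and "C_\<kappa> > 0" and "\<alpha>_max > 0"
  shows "\<exists>C>0. \<forall>dim :: real \<Rightarrow> nat. filterlim dim at_top (at_right 0) \<longrightarrow>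
    (\<forall>\<^sub>F \<delta> in at_right 0.
      \<forall>(\<alpha>::real) (lam :: nat \<Rightarrow> real) (\<kappa>::real) (mu :: nat \<Rightarrow> real)
        (M :: 'a measure) (eps :: nat \<Rightarrow> 'a \<Rightarrow> real).
        0 \<le> \<alpha> \<and> \<alpha> \<le> \<alpha>_max \<and> \<alpha> * p \<le> 1 / 4 \<and>
        singular_values (dim \<delta>) lam \<and> polynomial_decay p C_A (dim \<delta>) lam \<and>
        0 < \<kappa> \<and>
        \<bar>\<kappa> - (\<Sum>i=1..dim \<delta>. lam i powr (2 * \<alpha>) * \<delta>\<^sup>2)\<bar> \<le> C_\<kappa> * s_dim \<alpha> (dim \<delta>) lam * \<delta>\<^sup>2 \<and>
        standard_gaussian_noise M (dim \<delta>) eps \<longrightarrow>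
        stopped_risk M \<alpha> (dim \<delta>) lam mu \<delta> eps \<kappa>
          \<ge> C * s_dim \<alpha> (dim \<delta>) lam powr ((2 * p + 1) / (1 - 2 * \<alpha> * p)) * \<delta>\<^sup>2)"
proof -
  define a where "a = 2 * C_A powr (2 * \<alpha>_max)"
  \<comment> \<open>\<open>a\<close> bounds the discarded head and \<open>C_\<kappa>\<close> the error in \<open>\<kappa>\<close>, both in units of \<open>s_dim\<close>\<close>
  define t where "t = 2 * (a + C_\<kappa>) + 1"
  define c where "c = exp (- 14 * t\<^sup>2) / 8"
  define e where "e = (1 / 8 :: real) powr (2 * p + 1) / C_A\<^sup>2"
  have pos: "0 < c" "0 < e" "0 \<le> a" "1 \<le> t" using assms by (auto simp: c_def e_def a_def t_def)
  show ?thesis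
  proof (intro exI[of _ "c * e"] conjI allI impI)
    show "0 < c * e" using pos by simp
    fix dim :: "real \<Rightarrow> nat" assume dim: "filterlim dim at_top (at_right 0)"
    \<comment> \<open>the smallness of \<open>\<delta>\<close> enters through \<open>dim\<close> only: it makes \<open>s_dim\<close> at least \<open>16 * t\<close>\<close>
    have "filterlim (\<lambda>\<delta>. harm (dim \<delta>) :: real) at_top (at_right 0)"
      by (rule filterlim_compose[OF harm_at_top dim])
    then have "\<forall>\<^sub>F \<delta> in at_right 0. (16 * t)\<^sup>2 / (2 * C_A powr (- 4 * \<alpha>_max)) \<le> harm (dim \<delta>)"
      by (simp add: filterlim_at_top)
    moreover have "\<forall>\<^sub>F \<delta> in at_right 0. (0::real) < \<delta>" by (rule eventually_at_right_less)
    ultimately show "\<forall>\<^sub>F \<delta> in at_right 0.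
      \<forall>(\<alpha>::real) (lam :: nat \<Rightarrow> real) (\<kappa>::real) (mu :: nat \<Rightarrow> real)
        (M :: 'a measure) (eps :: nat \<Rightarrow> 'a \<Rightarrow> real).
        0 \<le> \<alpha> \<and> \<alpha> \<le> \<alpha>_max \<and> \<alpha> * p \<le> 1 / 4 \<and>
        singular_values (dim \<delta>) lam \<and> polynomial_decay p C_A (dim \<delta>) lam \<and>
        0 < \<kappa> \<and>
        \<bar>\<kappa> - (\<Sum>i=1..dim \<delta>. lam i powr (2 * \<alpha>) * \<delta>\<^sup>2)\<bar> \<le> C_\<kappa> * s_dim \<alpha> (dim \<delta>) lam * \<delta>\<^sup>2 \<and>
        standard_gaussian_noise M (dim \<delta>) eps \<longrightarrow>
        stopped_risk M \<alpha> (dim \<delta>) lam mu \<delta> eps \<kappa>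
          \<ge> c * e * s_dim \<alpha> (dim \<delta>) lam powr ((2 * p + 1) / (1 - 2 * \<alpha> * p)) * \<delta>\<^sup>2"
    proof (eventually_elim, intro allI impI, elim conjE)
      fix \<delta> \<alpha> \<kappa> :: real and lam mu :: "nat \<Rightarrow> real" and M :: "'a measure" and eps
      assume harm: "(16 * t)\<^sup>2 / (2 * C_A powr (- 4 * \<alpha>_max)) \<le> harm (dim \<delta>)" and \<delta>: "0 < \<delta>"
        and \<alpha>: "0 \<le> \<alpha>" "\<alpha> \<le> \<alpha>_max" "\<alpha> * p \<le> 1 / 4"
        and lam: "singular_values (dim \<delta>) lam" "polynomial_decay p C_A (dim \<delta>) lam"
        and \<kappa>: "0 < \<kappa>" "\<bar>\<kappa> - (\<Sum>i=1..dim \<delta>. lam i powr (2 * \<alpha>) * \<delta>\<^sup>2)\<bar>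
          \<le> C_\<kappa> * s_dim \<alpha> (dim \<delta>) lam * \<delta>\<^sup>2"
        and noise: "standard_gaussian_noise M (dim \<delta>) eps"
      define D where "D = dim \<delta>"
      note [folded D_def] = harm lam \<kappa> noise
      note harm = this(1) and lam = this(2,3) and \<kappa> = this(4,5) and noise = this(6)
      define s where "s = s_dim \<alpha> D lam"
      define w where "w = (\<lambda>i. lam i powr (2 * \<alpha>))"
      define \<nu> where "\<nu> = (\<lambda>i. lam i * mu i / \<delta>)"
      have "(16 * t)\<^sup>2 \<le> 2 * C_A powr (- 4 * \<alpha>_max) * harm D"
        using harm assms by (simp add: field_simps)
      also have "\<dots> \<le> s\<^sup>2"
        unfolding s_def by (rule harm_le_s_dim_sq[OF lam(2) \<alpha> assms(2)])
      finally have large: "16 * t \<le> s"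
        by (rule power2_le_imp_le) (simp add: s_def s_dim_def sum_nonneg)
      then have s2: "2 \<le> s" using pos by simp
      obtain m where m: "m \<le> D" and head: "(\<Sum>i=1..m. w i) \<le> a * s"
        and inv: "e * s powr ((2 * p + 1) / (1 - 2 * \<alpha> * p)) \<le> (\<Sum>i=1..m. (inverse (lam i))\<^sup>2)"
        using exists_truncation_level[OF lam assms(1) \<alpha> assms(2) s_def s2]
        unfolding a_def e_def w_def by blast
      have lam_pos: "0 < lam i" "lam i \<le> 1" if "i \<in> {1..D}" for i
        using lam(1) that by (auto simp: singular_values_def)
      have sw: "s = sqrt (2 * (\<Sum>i=1..D. (w i)\<^sup>2))"
        by (simp add: s_def s_dim_def w_def power2_eq_square powr_add[symmetric])
      have "\<kappa> \<le> ((\<Sum>i=1..D. w i) + C_\<kappa> * s) * \<delta>\<^sup>2"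
        using \<kappa>(2) unfolding w_def s_def distrib_right sum_distrib_right by linarith
      then have T: "\<kappa> / \<delta>\<^sup>2 \<le> (\<Sum>i=1..D. w i) + C_\<kappa> * s" using \<delta> by (simp add: field_simps)
      have res: "smoothed_residual_sq \<alpha> D lam (observation lam mu \<delta> eps \<omega>) m
          = \<delta>\<^sup>2 * (\<Sum>i=m+1..D. w i * (\<nu> i + eps i \<omega>)\<^sup>2)" for \<omega>
        unfolding smoothed_residual_sq_def observation_def sum_distrib_left
      proof (intro sum.cong refl)
        fix i
        have "lam i * mu i + \<delta> * eps i \<omega> = \<delta> * (\<nu> i + eps i \<omega>)"
          using \<delta> by (simp add: \<nu>_def field_simps)
        then show "lam i powr (2 * \<alpha>) * (lam i * mu i + \<delta> * eps i \<omega>)\<^sup>2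
            = \<delta>\<^sup>2 * (w i * (\<nu> i + eps i \<omega>)\<^sup>2)"
          by (simp add: w_def power_mult_distrib)
      qed
      have "c \<le> measure M {\<omega> \<in> space M. \<kappa> / \<delta>\<^sup>2 < (\<Sum>i=m+1..D. w i * (\<nu> i + eps i \<omega>)\<^sup>2)}"
        unfolding c_def
      proof (rule prob_tail_exceeds_threshold[OF noise m _ sw head T pos(3) _ t_def large])
        show "0 \<le> w i \<and> w i \<le> 1" if "i \<in> {1..D}" for i
          using lam_pos[OF that] \<alpha> by (auto simp: w_def intro!: powr_le1)
      qed (use assms in simp)
      also have "{\<omega> \<in> space M. \<kappa> / \<delta>\<^sup>2 < (\<Sum>i=m+1..D. w i * (\<nu> i + eps i \<omega>)\<^sup>2)}
        = {\<omega> \<in> space M. \<kappa> < smoothed_residual_sq \<alpha> D lam (observation lam mu \<delta> eps \<omega>) m}"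
        using \<delta> by (auto simp: res field_simps)
      finally have prob: "c \<le> measure M \<dots>" .
      have "c * e * s powr ((2 * p + 1) / (1 - 2 * \<alpha> * p)) * \<delta>\<^sup>2
          = \<delta>\<^sup>2 * (e * s powr ((2 * p + 1) / (1 - 2 * \<alpha> * p))) * c" by simp
      also have "\<dots> \<le> \<delta>\<^sup>2 * (\<Sum>i=1..m. (inverse (lam i))\<^sup>2) *
          measure M {\<omega> \<in> space M. \<kappa> < smoothed_residual_sq \<alpha> D lam (observation lam mu \<delta> eps \<omega>) m}"
        using inv prob pos by (intro mult_mono) (auto simp: sum_nonneg)
      also have "\<dots> \<le> stopped_risk M \<alpha> D lam mu \<delta> eps \<kappa>"
        using \<kappa>(1) lam_pos(1) by (intro stopped_risk_ge[OF noise _ m]) auto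
      finally show "c * e * s_dim \<alpha> (dim \<delta>) lam powr ((2 * p + 1) / (1 - 2 * \<alpha> * p)) * \<delta>\<^sup>2
          \<le> stopped_risk M \<alpha> (dim \<delta>) lam mu \<delta> eps \<kappa>"
        by (simp add: s_def D_def)
    qed
  qed
qed

end
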